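(* Let $D$ be a domain in $\mathbb{C}$. Assume that $\overline{\mathbb{C}}\setminus D$ has finitely many connected components and that no connected component is a single point. Then $$\lim_{z\rightarrow \partial D} s_D(z) = 1.$$ In particular, $D$ is a holomorphic homogeneous regular domain.
   Context: $\overline{\mathbb{C}}$ is the Riemann sphere, $\partial D$ is the boundary of $D$ in $\overline{\mathbb{C}}$, and $\lim_{z\to\partial D}s_D(z)=1$ means that for every $\epsilon>0$ there is a compact set $K\subset D$ with $s_D(z)>1-\epsilon$ for all $z\in D\setminus K$. $\Delta$ is the open unit disc and $\Delta_r$ the open disc with center $0$ and radius $r$. The squeezing function of $D$ is $s_D(p)=\sup_f\,\sup\{r:\Delta_r\subset f(D)\}$, where the outer supremum is over all injective holomorphic maps $f:D\to\Delta$ with $f(p)=0$; it is a biholomorphic invariant. A holomorphic homogeneous regular domain is a domain, biholomorphic to a bounded domain, whose squeezing function has a positive lower bound. *)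

theory Defs
  imports "HOL-Analysis.Analysis" "HOL-Complex_Analysis.Complex_Analysis"
begin

(* A domain is nonempty by convention. *)
definition planar_domain :: "complex set \<Rightarrow> bool" where
  "planar_domain D \<longleftrightarrow> open D \<and> connected D \<and> D \<noteq> {}"

(* Some embeds the plane and None is the point at infinity. *)
definition riemann_sphere :: "complex option topology" where
  "riemann_sphere = Alexandroff_compactification euclidean"

definition sphere_complement :: "complex set \<Rightarrow> complex option set" where
  "sphere_complement D = topspace riemann_sphere - Some ` D"

definition squeezing_maps :: "complex set \<Rightarrow> complex \<Rightarrow> (complex \<Rightarrow> complex) set" where
  "squeezing_maps D p =
     {f. f holomorphic_on D \<and> inj_on f D \<and> f ` D \<subseteq> ball 0 1 \<and> f p = 0}"

(* For a domain D and p in D, both suprema are over sets bounded above by 1 and the inner set is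
   nonempty by the open mapping theorem. The outer set is nonempty whenever D is biholomorphic to
   a bounded domain; otherwise the value is the unspecified supremum of the empty set. *)
definition squeezing_function :: "complex set \<Rightarrow> complex \<Rightarrow> real" where
  "squeezing_function D p =
     (SUP f\<in>squeezing_maps D p. Sup {r. 0 < r \<and> ball 0 r \<subseteq> f ` D})"

(* Convergence to 1 at the boundary; only the lower estimate appears because the squeezing
   function is at most 1. *)
definition squeezing_tends_to_one_at_boundary :: "complex set \<Rightarrow> bool" where
  "squeezing_tends_to_one_at_boundary D \<longleftrightarrow>
     (\<forall>\<epsilon>>0. \<exists>K. compact K \<and> K \<subseteq> D \<and> (\<forall>z\<in>D - K. squeezing_function D z > 1 - \<epsilon>))"

definition biholomorphic :: "complex set \<Rightarrow> complex set \<Rightarrow> bool" where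
  "biholomorphic D E \<longleftrightarrow>
     (\<exists>f g. f holomorphic_on D \<and> g holomorphic_on E \<and> f ` D \<subseteq> E \<and> g ` E \<subseteq> D \<and>
            (\<forall>z\<in>D. g (f z) = z) \<and> (\<forall>w\<in>E. f (g w) = w))"

definition holomorphic_homogeneous_regular :: "complex set \<Rightarrow> bool" where
  "holomorphic_homogeneous_regular D \<longleftrightarrow>
     planar_domain D \<and>
     (\<exists>E. planar_domain E \<and> bounded E \<and> biholomorphic D E) \<and>
     (\<exists>c>0. \<forall>z\<in>D. c \<le> squeezing_function D z)"

end

theory Submission
  imports Defs
begin

text \<open>Let \<open>C\<close> be a component of the complement of \<open>D\<close> on the sphere. The complement of \<open>C\<close> is
  simply connected, hence has a Riemann map \<open>f\<close> onto the disc, and \<open>f ` D\<close> omits only a compact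
  subset of the disc because the other components are finitely many. As \<open>z\<close> approaches \<open>C\<close>,
  \<open>\<bar>f z\<bar>\<close> tends to 1, and the disc automorphism moving \<open>f z\<close> to 0 pushes that compact set to the
  unit circle. Composing it with \<open>f\<close> shows that the squeezing function tends to 1 at \<open>C\<close>.\<close>

section \<open>Disc automorphisms and lower bounds for the squeezing function\<close>

text \<open>The numerator \<open>z - w\<close> differs from \<open>- w * (1 - cnj w * z)\<close>
  only by \<open>(1 - (norm w)\<^sup>2) * z\<close>, and the denominator has norm at least
  \<open>1 - \<rho>\<close>. The constant depends on \<open>\<rho>\<close> alone, so the estimate is
  uniform on compact subsets of the disc.\<close>

lemma Moebius_function_norm_ge:
  assumes w: "norm w < 1" and z: "norm z \<le> \<rho>" and \<rho>: "0 \<le> \<rho>" "\<rho> < 1"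
  shows "norm (Moebius_function 0 w z) \<ge> 1 - (1 - norm w) * (1 + 2 / (1 - \<rho>))"
proof -
  have wz: "norm (cnj w * z) \<le> \<rho>"
    using mult_mono[of "norm w" 1 "norm z" \<rho>] w z \<rho> by (simp add: norm_mult)
  have "1 - norm (cnj w * z) \<le> norm (1 - cnj w * z)"
    using norm_triangle_ineq2[of 1 "cnj w * z"] by simp
  with wz have den: "1 - \<rho> \<le> norm (1 - cnj w * z)"
    by linarith
  define d where "d = norm (1 - cnj w * z)"
  have d: "0 < d" "1 - \<rho> \<le> d" using den \<rho> by (auto simp: d_def)
  have "w * (1 - cnj w * z) = - (z - w) + of_real (1 - (norm w)\<^sup>2) * z"
    by (simp only: of_real_diff of_real_1 complex_norm_square) (simp add: algebra_simps)
  then have "norm w * d \<le> norm (z - w) + norm (of_real (1 - (norm w)\<^sup>2) * z)"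
    unfolding d_def norm_mult[symmetric]
    using norm_triangle_ineq[of "- (z - w)" "of_real (1 - (norm w)\<^sup>2) * z"]
    by (simp only: norm_minus_cancel)
  moreover have "norm (of_real (1 - (norm w)\<^sup>2) * z) \<le> 2 * (1 - norm w)"
  proof -
    have sq: "1 - (norm w)\<^sup>2 = (1 - norm w) * (1 + norm w)"
      by (simp add: power2_eq_square algebra_simps)
    have "norm (of_real (1 - (norm w)\<^sup>2) * z) = (1 - norm w) * (1 + norm w) * norm z"
      using w unfolding norm_mult norm_of_real sq by (simp add: abs_mult)
    also have "\<dots> \<le> (1 - norm w) * 2 * 1"
      using w z \<rho> by (intro mult_mono) auto
    finally show ?thesis by simp
  qed
  ultimately have "norm w * d - 2 * (1 - norm w) \<le> norm (z - w)" by linarith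
  then have "norm w - 2 * (1 - norm w) / d \<le> norm (z - w) / d"
    using d divide_right_mono[of _ _ d] by (fastforce simp: diff_divide_distrib)
  moreover have "2 * (1 - norm w) / d \<le> 2 * (1 - norm w) / (1 - \<rho>)"
    using d w \<rho> by (intro divide_left_mono) auto
  ultimately show ?thesis
    unfolding Moebius_function_simple norm_divide d_def[symmetric] by (simp add: algebra_simps)
qed

text \<open>Suprema of reals need care: the inner sets are bounded by 1 because images lie in the
  unit disc, and nonempty by the open mapping theorem at the point 0.\<close>

lemma le_squeezing_function:
  assumes "planar_domain D" "p \<in> D" and f: "f \<in> squeezing_maps D p"
    and r: "0 < r" "ball 0 r \<subseteq> f ` D"
  shows "r \<le> squeezing_function D p"
proof -
  have le1: "s \<le> 1" if "0 < s" "ball 0 s \<subseteq> h ` D" "h \<in> squeezing_maps D p" for s h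
  proof -
    have "ball (0::complex) s \<subseteq> ball 0 1"
      using that by (auto simp: squeezing_maps_def)
    then show ?thesis using \<open>0 < s\<close> by (simp add: ball_subset_ball_iff)
  qed
  have ne: "{s. 0 < s \<and> ball 0 s \<subseteq> h ` D} \<noteq> {}" if "h \<in> squeezing_maps D p" for h
  proof -
    have "open (h ` D)"
      using assms that by (intro open_mapping_thm3) (auto simp: planar_domain_def squeezing_maps_def)
    moreover have "0 \<in> h ` D"
      using that \<open>p \<in> D\<close> by (force simp: squeezing_maps_def)
    ultimately show ?thesis
      using open_contains_ball by blast
  qed
  have "r \<le> Sup {s. 0 < s \<and> ball 0 s \<subseteq> f ` D}"
    using le1 f r by (intro cSup_upper bdd_aboveI[of _ 1]) auto
  also have "\<dots> \<le> squeezing_function D p"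
    unfolding squeezing_function_def
  proof (rule cSUP_upper[OF f])
    show "bdd_above ((\<lambda>f. Sup {r. 0 < r \<and> ball 0 r \<subseteq> f ` D}) ` squeezing_maps D p)"
      using ne le1 by (intro bdd_aboveI2[of _ _ 1] cSup_least) auto
  qed
  finally show ?thesis .
qed

text \<open>Half of biholomorphic invariance; it brings maps found after an inversion back to the
  original domain.\<close>

lemma squeezing_maps_compose:
  assumes "f \<in> squeezing_maps (\<phi> ` D) (\<phi> p)" "\<phi> holomorphic_on D" "inj_on \<phi> D"
  shows "f \<circ> \<phi> \<in> squeezing_maps D p"
  using assms by (auto simp: squeezing_maps_def image_comp intro: comp_inj_on holomorphic_on_compose)

section \<open>Filling in a compact set, Riemann maps and inversion\<close>

text \<open>A component of \<open>E \<union> K\<close> missing \<open>E\<close> would lie in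
  \<open>K\<close> and have its frontier both in \<open>K\<close> and outside
  \<open>E \<union> K\<close>. Its frontier would be empty and the component the whole space, which
  is unbounded. So every component meets the connected set \<open>E\<close> and hence contains
  it.\<close>

lemma connected_Un_compact:
  fixes E K :: "'a::euclidean_space set"
  assumes "connected E" "compact K" "open (E \<union> K)"
  shows "connected (E \<union> K)"
proof -
  have meets: "W \<inter> E \<noteq> {}" if W: "W \<in> components (E \<union> K)" for W
  proof
    assume "W \<inter> E = {}"
    then have WK: "W \<subseteq> K" using in_components_subset[OF W] by blast
    have "frontier W \<subseteq> - (E \<union> K)"
      using W assms(3) frontier_of_components_closed_complement[of "- (E \<union> K)" W]
      by (simp add: closed_def)
    moreover have "frontier W \<subseteq> K"
      using closure_minimal[OF WK] \<open>compact K\<close> by (auto simp: compact_imp_closed frontier_def)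
    ultimately have "frontier W = {}" by blast
    then have "W = UNIV"
      using in_components_nonempty[OF W] by (simp add: frontier_eq_empty)
    moreover have "bounded W"
      using WK \<open>compact K\<close> bounded_subset compact_imp_bounded by blast
    ultimately show False by simp
  qed
  have "E \<subseteq> W" if "W \<in> components (E \<union> K)" for W
    using components_maximal[OF that \<open>connected E\<close>] meets[OF that] by blast
  then show ?thesis
    unfolding connected_eq_connected_components_eq using meets components_eq by blast
qed

text \<open>The clopen hypothesis says that \<open>- (E \<union> K)\<close> together with \<open>\<infinity>\<close> is connected.\<close>

lemma Riemann_map_Un_compact:
  fixes E K :: "complex set"
  assumes "connected E" "E \<noteq> {}" "compact K" "open (E \<union> K)" "E \<union> K \<noteq> UNIV"
    and clopen: "\<And>M. \<lbrakk>compact M; openin (top_of_set (- (E \<union> K))) M\<rbrakk> \<Longrightarrow> M = {}"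
  obtains f g where "f holomorphic_on (E \<union> K)" "g holomorphic_on ball 0 1"
    "\<And>z. z \<in> E \<union> K \<Longrightarrow> f z \<in> ball 0 1 \<and> g (f z) = z"
    "\<And>z. z \<in> ball 0 1 \<Longrightarrow> g z \<in> E \<union> K \<and> f (g z) = z"
proof -
  define F where "F = - (E \<union> K)"
  have "closed F" using assms by (simp add: F_def closed_def)
  have "\<not> bounded B" if B: "B \<in> components F" for B
  proof
    assume "bounded B"
    then have "compact B"
      using closed_components[OF \<open>closed F\<close> B] compact_eq_bounded_closed by blast
    \<comment> \<open>A component need not be open in \<open>F\<close>, but by Sura-Bura a compact
      one lies in a compact clopen subset of \<open>F\<close>, which the hypothesis makes
      empty.\<close>
    then obtain M where "openin (top_of_set F) M" "compact M" "B \<subseteq> M"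
      using Sura_Bura_clopen_subset[OF closed_imp_locally_compact[OF \<open>closed F\<close>] B, of UNIV] by auto
    then have "B = {}" using clopen by (auto simp: F_def)
    then show False using in_components_nonempty[OF B] by blast
  qed
  moreover have "connected (E \<union> K)"
    using assms connected_Un_compact by blast
  ultimately have "simply_connected (E \<union> K)"
    using simply_connected_eq_unbounded_complement_components[OF \<open>open (E \<union> K)\<close>] by (simp add: F_def)
  then show ?thesis
    using Riemann_mapping_theorem[of "E \<union> K"] assms that by fast
qed

text \<open>Follow a Riemann map \<open>f\<close> of \<open>E \<union> K\<close> by the disc
  automorphism taking \<open>f z\<close> to 0. The image of \<open>E\<close> can miss only the moved
  copy of the image of \<open>K\<close>, which is close to the circle once \<open>norm (f z)\<close>
  is close to 1.\<close>

lemma squeezing_maps_Un_compact: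
  fixes E K :: "complex set"
  assumes "connected E" "E \<noteq> {}" "compact K" "open (E \<union> K)" "E \<union> K \<noteq> UNIV"
    and "\<And>M. \<lbrakk>compact M; openin (top_of_set (- (E \<union> K))) M\<rbrakk> \<Longrightarrow> M = {}"
    and \<epsilon>: "0 < \<epsilon>"
  obtains L where "compact L" "L \<subseteq> E \<union> K"
    "\<And>z. z \<in> E - L \<Longrightarrow> \<exists>h \<in> squeezing_maps E z. ball 0 (1 - \<epsilon>) \<subseteq> h ` E"
proof -
  obtain f g where f: "f holomorphic_on (E \<union> K)" and g: "g holomorphic_on ball 0 1"
    and gf: "\<And>z. z \<in> E \<union> K \<Longrightarrow> f z \<in> ball 0 1 \<and> g (f z) = z"
    and fg: "\<And>z. z \<in> ball 0 1 \<Longrightarrow> g z \<in> E \<union> K \<and> f (g z) = z"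
    using Riemann_map_Un_compact[OF assms(1-6)] by blast
  have "compact (f ` K)"
    using f \<open>compact K\<close>
    by (intro compact_continuous_image) (auto intro: holomorphic_on_imp_continuous_on holomorphic_on_subset)
  \<comment> \<open>The maximum of \<open>norm (f z)\<close> over \<open>K\<close> serves as
    \<open>\<rho>\<close>, and 0 if \<open>K\<close> is empty.\<close>
  then obtain \<rho> where \<rho>: "0 \<le> \<rho>" "\<rho> < 1" "\<And>z. z \<in> K \<Longrightarrow> norm (f z) \<le> \<rho>"
  proof (cases "K = {}")
    case False
    then obtain z0 where "z0 \<in> K" "\<And>z. z \<in> K \<Longrightarrow> norm (f z) \<le> norm (f z0)"
      using continuous_attains_sup[OF \<open>compact (f ` K)\<close> _ continuous_on_norm_id] by auto
    then show ?thesis using gf[of z0] that[of "norm (f z0)"] by auto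
  qed (use that[of 0] in auto)
  \<comment> \<open>\<open>c\<close> is the constant of \<open>Moebius_function_norm_ge\<close>, and
    \<open>R\<close> is chosen so that \<open>norm w > R\<close> means
    \<open>(1 - norm w) * c < \<epsilon>\<close>. If \<open>R\<close> is negative, \<open>L\<close>
    is empty.\<close>
  define c where "c = 1 + 2 / (1 - \<rho>)"
  have c: "0 < c" using \<rho> by (simp add: c_def add_pos_pos)
  define R where "R = 1 - \<epsilon> / c"
  define L where "L = g ` cball 0 R"
  have R: "R < 1" using c \<epsilon> by (simp add: R_def)
  have sub: "cball 0 R \<subseteq> ball (0::complex) 1" using R by auto
  show thesis
  proof
    show "compact L"
      unfolding L_def using g sub
      by (intro compact_continuous_image) (auto intro: holomorphic_on_imp_continuous_on holomorphic_on_subset)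
    show "L \<subseteq> E \<union> K" using fg sub by (fastforce simp: L_def)
    fix z assume z: "z \<in> E - L"
    define w where "w = f z"
    have w: "norm w < 1" using gf[of z] z by (simp add: w_def)
    have "\<not> norm w \<le> R"
    proof
      assume "norm w \<le> R"
      then have "g w \<in> L" by (simp add: L_def)
      then show False using z gf[of z] by (simp add: w_def)
    qed
    then have small: "(1 - norm w) * c < \<epsilon>"
      using c by (simp add: R_def field_simps)
    define h where "h = Moebius_function 0 w \<circ> f"
    have inv: "Moebius_function 0 (- w) (Moebius_function 0 w x) = x"
              "Moebius_function 0 w (Moebius_function 0 (- w) x) = x" if "norm x < 1" for x
      using Moebius_function_compose[of "-w" w x] Moebius_function_compose[of w "-w" x] w that by auto
    have "h holomorphic_on E"
      unfolding h_def using gf w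
      by (intro holomorphic_on_compose_gen[of f E _ "ball 0 1"])
        (auto intro: Moebius_function_holomorphic holomorphic_on_subset[OF f])
    moreover have "inj_on h E"
    proof (rule inj_on_inverseI)
      fix x assume "x \<in> E"
      then show "(g \<circ> Moebius_function 0 (- w)) (h x) = x"
        using gf[of x] inv(1)[of "f x"] by (simp add: h_def)
    qed
    moreover have "h ` E \<subseteq> ball 0 1"
      using gf Moebius_function_norm_lt_1[OF w] by (force simp: h_def)
    moreover have "h z = 0" by (simp add: h_def w_def Moebius_function_eq_zero)
    ultimately have "h \<in> squeezing_maps E z" by (simp add: squeezing_maps_def)
    moreover have "ball 0 (1 - \<epsilon>) \<subseteq> h ` E"
    proof
      fix y :: complex assume "y \<in> ball 0 (1 - \<epsilon>)"
      then have y: "norm y < 1 - \<epsilon>" by simp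
      define x where "x = Moebius_function 0 (- w) y"
      have x: "norm x < 1" "Moebius_function 0 w x = y"
        using y \<epsilon> w inv(2)[of y] by (auto simp: x_def intro: Moebius_function_norm_lt_1)
      \<comment> \<open>If \<open>g x\<close> lay in \<open>K\<close>, then
        \<open>norm x \<le> \<rho>\<close>, and the Moebius estimate would force
        \<open>norm y > 1 - \<epsilon>\<close>.\<close>
      have "g x \<notin> K"
      proof
        assume "g x \<in> K"
        then have "norm x \<le> \<rho>" using \<rho>(3)[of "g x"] fg[of x] x by simp
        then have "norm y \<ge> 1 - (1 - norm w) * c"
          using Moebius_function_norm_ge[OF w _ \<rho>(1,2)] x by (auto simp: c_def)
        then show False using small y by linarith
      qed
      then have "g x \<in> E" "h (g x) = y" using fg[of x] x by (auto simp: h_def)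
      then show "y \<in> h ` E" by blast
    qed
    ultimately show "\<exists>h \<in> squeezing_maps E z. ball 0 (1 - \<epsilon>) \<subseteq> h ` E" by blast
  qed
qed

text \<open>The map \<open>1 / (z - a)\<close> with \<open>a \<in> C\<close> turns \<open>C\<close> into a closed set without bounded components,
  so that the previous lemma applies to the image of \<open>D\<close>.\<close>

lemma squeezing_maps_bounded_component:
  fixes D C :: "complex set"
  assumes D: "open D" "connected D" "D \<noteq> {}"
    and C: "compact C" "open V" "C = V - D" "a \<in> C" "C \<noteq> {a}"
    and clopen: "\<And>M. \<lbrakk>M \<subseteq> C; compact M; openin (top_of_set C) M\<rbrakk> \<Longrightarrow> M = {} \<or> M = C"
    and \<epsilon>: "0 < \<epsilon>"
  obtains L where "closed L" "L \<inter> C = {}"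
    "\<And>z. z \<in> D - L \<Longrightarrow> \<exists>h \<in> squeezing_maps D z. ball 0 (1 - \<epsilon>) \<subseteq> h ` D"
proof -
  \<comment> \<open>Division by 0 yields 0, so \<open>\<iota>\<close> and \<open>\<kappa>\<close>
    are inverse bijections of the whole plane with \<open>\<iota> a = 0\<close> and
    \<open>\<kappa> 0 = a\<close>. Only continuity and holomorphy have to avoid these
    points.\<close>
  define \<iota> :: "complex \<Rightarrow> complex" where "\<iota> = (\<lambda>z. 1 / (z - a))"
  define \<kappa> :: "complex \<Rightarrow> complex" where "\<kappa> = (\<lambda>w. a + 1 / w)"
  have \<kappa>\<iota>: "\<kappa> (\<iota> z) = z" for z by (simp add: \<iota>_def \<kappa>_def)
  have \<iota>\<kappa>: "\<iota> (\<kappa> w) = w" for w by (simp add: \<iota>_def \<kappa>_def)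
  have inj: "inj \<iota>" by (metis \<kappa>\<iota> injI)
  have hol: "\<iota> holomorphic_on (- {a})" unfolding \<iota>_def by (intro holomorphic_intros) auto
  have \<kappa>cont: "continuous_on (- {0}) \<kappa>" unfolding \<kappa>_def by (intro continuous_intros) auto
  have \<iota>open: "open (\<iota> ` S)" if "open S" "a \<notin> S" for S
    using that hol inj
    by (intro open_mapping_thm3) (auto intro: holomorphic_on_subset inj_on_subset)
  have aD: "a \<notin> D" and aV: "a \<in> V" using C by auto
  have holD: "\<iota> holomorphic_on D" and injD: "inj_on \<iota> D"
    using hol aD inj by (auto intro: holomorphic_on_subset inj_on_subset)
  define E where "E = \<iota> ` D"
  define F where "F = \<iota> ` (C - {a})"
  \<comment> \<open>\<open>K\<close> consists of 0 and the images of the points outside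
    \<open>D \<union> C\<close>. Geometrically 0 is the image of infinity; by convention it is also
    \<open>\<iota> a\<close>.\<close>
  define K where "K = - E - F"
  have EF: "E \<inter> F = {}" using C inj by (auto simp: E_def F_def inj_eq)
  have EK: "E \<union> K = - F" using EF by (auto simp: K_def)
  obtain R where R: "R > 0" "C \<subseteq> cball a R"
    using bounded_subset_ballD[OF compact_imp_bounded[OF \<open>compact C\<close>], of a] ball_subset_cball
    by (meson subset_trans)
  have F_bound: "1 / R \<le> norm w" if w: "w \<in> F" for w
  proof -
    obtain z where z: "z \<in> C" "z \<noteq> a" "w = 1 / (z - a)" using w by (auto simp: F_def \<iota>_def)
    then have "norm (z - a) \<le> R" using R by (auto simp: dist_norm norm_minus_commute)
    then show ?thesis using z R by (auto simp: norm_divide intro!: divide_left_mono)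
  qed
  \<comment> \<open>Boundedness of \<open>C\<close> keeps \<open>F\<close> away from 0, where
    \<open>\<kappa>\<close> is discontinuous, so \<open>F\<close> is the preimage of
    \<open>C\<close> on a closed set on which \<open>\<kappa>\<close> is continuous.\<close>
  have "closed F"
  proof -
    have "F = (- ball 0 (1 / R)) \<inter> \<kappa> -` C"
    proof
      show "F \<subseteq> (- ball 0 (1 / R)) \<inter> \<kappa> -` C"
        using F_bound by (fastforce simp: F_def \<kappa>\<iota>)
      show "(- ball 0 (1 / R)) \<inter> \<kappa> -` C \<subseteq> F"
      proof
        fix w assume w: "w \<in> (- ball 0 (1 / R)) \<inter> \<kappa> -` C"
        then have "w \<noteq> 0" using R by auto
        then have "\<kappa> w \<noteq> a" by (simp add: \<kappa>_def)
        then show "w \<in> F" using w \<iota>\<kappa>[of w] unfolding F_def by (metis DiffI IntD2 image_eqI singletonD vimageE)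
      qed
    qed
    moreover have "continuous_on (- ball 0 (1 / R)) \<kappa>"
      using R by (intro continuous_on_subset[OF \<kappa>cont]) auto
    ultimately show ?thesis
      using \<open>compact C\<close> continuous_closed_preimage[of "- ball 0 (1 / R)" \<kappa> C]
      by (simp add: compact_imp_closed closed_Compl)
  qed
  \<comment> \<open>\<open>E \<union> F\<close> is the image of the open set
    \<open>D \<union> V - {a}\<close>, so \<open>K\<close> is closed. A ball around \<open>a\<close>
    inside \<open>V\<close> lies in \<open>D \<union> C\<close>, and the inversion turns it into a
    neighbourhood of infinity that \<open>K\<close> avoids.\<close>
  have "compact K"
  proof -
    have "D \<union> C = D \<union> V" using C by blast
    then have "E \<union> F = \<iota> ` (D \<union> V - {a})" using aD by (auto simp: E_def F_def)
    moreover have "open (\<iota> ` (D \<union> V - {a}))" using D C by (intro \<iota>open) auto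
    ultimately have "closed K"
      by (metis K_def Compl_Un Diff_eq closed_Compl)
    moreover obtain r where r: "r > 0" "ball a r \<subseteq> V"
      using \<open>open V\<close> aV open_contains_ball by blast
    have "norm w \<le> 1 / r" if w: "w \<in> K" for w
    proof -
      have "\<kappa> w \<notin> D" "\<kappa> w \<notin> C - {a}"
        using w \<iota>\<kappa>[of w] unfolding K_def E_def F_def by (metis ComplD DiffE image_eqI)+
      then have "\<kappa> w \<notin> V \<or> \<kappa> w = a" using C by blast
      then have "norm (1 / w) \<ge> r \<or> w = 0"
        using r by (force simp: \<kappa>_def dist_norm)
      then show ?thesis using r by (cases "w = 0") (auto simp: norm_divide field_simps)
    qed
    then have "bounded K" by (auto simp: bounded_iff)
    ultimately show ?thesis by (simp add: compact_eq_bounded_closed)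
  qed
  have "connected E" "E \<noteq> {}"
    unfolding E_def using D holD
    by (auto intro: connected_continuous_image holomorphic_on_imp_continuous_on)
  moreover have "open (E \<union> K)" "E \<union> K \<noteq> UNIV"
    using \<open>closed F\<close> C EK by (auto simp: F_def)
  \<comment> \<open>\<open>\<kappa>\<close> carries \<open>M\<close> to a compact, relatively open
    subset of \<open>C\<close> that misses \<open>a\<close>, hence is not all of
    \<open>C\<close>.\<close>
  moreover have "M = {}" if M: "compact M" "openin (top_of_set (- (E \<union> K))) M" for M
  proof -
    obtain T where T: "open T" "M = F \<inter> T" using M(2) by (auto simp: EK openin_open)
    have "0 \<notin> F" using F_bound[of 0] R by auto
    then have M0: "0 \<notin> M" using T by blast
    have "\<kappa> ` F = C - {a}" by (simp add: F_def image_image \<kappa>\<iota>)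
    then have kM: "\<kappa> ` M \<subseteq> C - {a}" using T by blast
    have "compact (\<kappa> ` M)"
      using M M0 by (intro compact_continuous_image continuous_on_subset[OF \<kappa>cont]) auto
    moreover have "openin (top_of_set C) (\<kappa> ` M)"
    proof -
      have "\<kappa> ` M = C \<inter> ((- {a}) \<inter> \<iota> -` T)"
      proof
        show "\<kappa> ` M \<subseteq> C \<inter> ((- {a}) \<inter> \<iota> -` T)" using kM T(2) \<iota>\<kappa> by fastforce
        show "C \<inter> ((- {a}) \<inter> \<iota> -` T) \<subseteq> \<kappa> ` M"
        proof
          fix z assume "z \<in> C \<inter> ((- {a}) \<inter> \<iota> -` T)"
          then have "\<iota> z \<in> M" unfolding T(2) F_def by blast
          then show "z \<in> \<kappa> ` M" using \<kappa>\<iota>[of z] by (metis image_eqI)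
        qed
      qed
      moreover have "open ((- {a}) \<inter> \<iota> -` T)"
        using T continuous_open_preimage[of "- {a}" \<iota> T] holomorphic_on_imp_continuous_on[OF hol]
        by (simp add: open_Compl)
      ultimately show ?thesis using openin_open by blast
    qed
    ultimately have "\<kappa> ` M = {} \<or> \<kappa> ` M = C" using clopen kM by blast
    then show ?thesis using kM C by blast
  qed
  ultimately obtain L where L: "compact L" "L \<subseteq> E \<union> K"
    "\<And>z. z \<in> E - L \<Longrightarrow> \<exists>h \<in> squeezing_maps E z. ball 0 (1 - \<epsilon>) \<subseteq> h ` E"
    using squeezing_maps_Un_compact[OF _ _ \<open>compact K\<close> _ _ _ \<epsilon>] by metis
  obtain B where B: "B > 0" "L \<subseteq> cball 0 B"
    using bounded_subset_ballD[OF compact_imp_bounded[OF \<open>compact L\<close>], of 0] ball_subset_cball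
    by (meson subset_trans)
  \<comment> \<open>Removing the ball around \<open>a\<close> makes the preimage closed, as
    \<open>\<iota>\<close> is discontinuous at \<open>a\<close>. It loses no point of
    \<open>D\<close>: if \<open>z \<noteq> a\<close> and \<open>\<iota> z \<in> L\<close>, then
    \<open>norm (\<iota> z) \<le> B\<close> puts \<open>z\<close> at distance at least
    \<open>1 / B\<close> from \<open>a\<close>.\<close>
  define L' where "L' = (- ball a (1 / B)) \<inter> \<iota> -` L"
  show thesis
  proof
    have "continuous_on (- ball a (1 / B)) \<iota>"
      using B by (intro continuous_on_subset[OF holomorphic_on_imp_continuous_on[OF hol]]) auto
    then show "closed L'"
      using \<open>compact L\<close> continuous_closed_preimage[of "- ball a (1 / B)" \<iota> L]
      by (simp add: L'_def compact_imp_closed closed_Compl)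
    show "L' \<inter> C = {}"
    proof -
      have "a \<notin> L'" using B by (auto simp: L'_def)
      moreover have "z \<notin> L'" if "z \<in> C - {a}" for z
        using that L EK by (auto simp: L'_def F_def)
      ultimately show ?thesis by blast
    qed
    fix z assume z: "z \<in> D - L'"
    have "\<iota> z \<notin> L"
    proof
      assume \<iota>z: "\<iota> z \<in> L"
      then have "norm (\<iota> z) \<le> B" using B by auto
      moreover have "z \<noteq> a" using z aD by auto
      ultimately have "1 / B \<le> norm (z - a)" using B by (simp add: \<iota>_def norm_divide field_simps)
      then show False using z \<iota>z by (auto simp: L'_def dist_norm norm_minus_commute)
    qed
    then obtain h where "h \<in> squeezing_maps E (\<iota> z)" "ball 0 (1 - \<epsilon>) \<subseteq> h ` E"
      using L(3)[of "\<iota> z"] z by (auto simp: E_def)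
    then have "h \<circ> \<iota> \<in> squeezing_maps D z" "ball 0 (1 - \<epsilon>) \<subseteq> (h \<circ> \<iota>) ` D"
      using squeezing_maps_compose holD injD by (auto simp: E_def image_comp)
    then show "\<exists>h \<in> squeezing_maps D z. ball 0 (1 - \<epsilon>) \<subseteq> h ` D" by blast
  qed
qed

section \<open>Clopen subsets of the complement on the sphere\<close>

lemma sphere_complement_eq: "sphere_complement D = insert None (Some ` (- D))"
  by (auto simp: sphere_complement_def riemann_sphere_def)

lemma openin_sphere_complement_Some:
  "openin (subtopology riemann_sphere (sphere_complement D)) (Some ` A) \<longleftrightarrow>
    (\<exists>V. open V \<and> A = V - D)"
proof
  assume "openin (subtopology riemann_sphere (sphere_complement D)) (Some ` A)"
  then obtain T where T: "openin riemann_sphere T" "Some ` A = T \<inter> sphere_complement D"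
    by (auto simp: openin_subtopology)
  then have "None \<notin> T" by (auto simp: sphere_complement_eq)
  then obtain V where V: "open V" "T = Some ` V"
    using T by (auto simp: riemann_sphere_def openin_Alexandroff_compactification)
  have "x \<in> A \<longleftrightarrow> x \<in> V - D" for x
  proof -
    have "x \<in> A \<longleftrightarrow> Some x \<in> Some ` A" by auto
    also have "\<dots> \<longleftrightarrow> x \<in> V - D" unfolding T(2) V by (auto simp: sphere_complement_eq)
    finally show ?thesis .
  qed
  then show "\<exists>V. open V \<and> A = V - D" using V by blast
next
  assume "\<exists>V. open V \<and> A = V - D"
  then obtain V where "open V" "A = V - D" by blast
  then have "openin riemann_sphere (Some ` V)" "Some ` A = Some ` V \<inter> sphere_complement D"
    by (auto simp: riemann_sphere_def sphere_complement_eq)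
  then show "openin (subtopology riemann_sphere (sphere_complement D)) (Some ` A)"
    unfolding openin_subtopology by blast
qed

text \<open>Open neighbourhoods of infinity are complements of compact sets; the closedness that a
  general compactification also asks for is automatic in the plane.\<close>

lemma openin_sphere_complement_None:
  "openin (subtopology riemann_sphere (sphere_complement D)) (insert None (Some ` A)) \<longleftrightarrow>
    (\<exists>Q. compact Q \<and> A = - D - Q)"
proof
  assume "openin (subtopology riemann_sphere (sphere_complement D)) (insert None (Some ` A))"
  then obtain T where T: "openin riemann_sphere T" "insert None (Some ` A) = T \<inter> sphere_complement D"
    by (auto simp: openin_subtopology)
  then have "None \<in> T" by auto
  then obtain Q where Q: "compact Q" "T = insert None (Some ` (- Q))"
    using T by (auto simp: riemann_sphere_def openin_Alexandroff_compactification Compl_eq_Diff_UNIV)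
  have "x \<in> A \<longleftrightarrow> x \<in> - D - Q" for x
  proof -
    have "x \<in> A \<longleftrightarrow> Some x \<in> insert None (Some ` A)" by auto
    also have "\<dots> \<longleftrightarrow> x \<in> - D - Q" unfolding T(2) Q by (auto simp: sphere_complement_eq)
    finally show ?thesis .
  qed
  then show "\<exists>Q. compact Q \<and> A = - D - Q" using Q by blast
next
  assume "\<exists>Q. compact Q \<and> A = - D - Q"
  then obtain Q where Q: "compact Q" "A = - D - Q" by blast
  then have "openin riemann_sphere (insert None (Some ` (- Q)))"
    by (auto simp: riemann_sphere_def openin_Alexandroff_compactification Compl_eq_Diff_UNIV compact_imp_closed)
  moreover have "insert None (Some ` A) = insert None (Some ` (- Q)) \<inter> sphere_complement D"
    using Q by (auto simp: sphere_complement_eq)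
  ultimately show "openin (subtopology riemann_sphere (sphere_complement D)) (insert None (Some ` A))"
    unfolding openin_subtopology by blast
qed

text \<open>\<open>M\<close> itself is the compact set whose removal shows the rest of the
  complement to be an open neighbourhood of infinity.\<close>

lemma clopen_sphere_complement_Some:
  assumes "open V" "compact M" "M = V - D"
  shows "openin (subtopology riemann_sphere (sphere_complement D)) (Some ` M)"
    and "closedin (subtopology riemann_sphere (sphere_complement D)) (Some ` M)"
proof -
  let ?X = "subtopology riemann_sphere (sphere_complement D)"
  show "openin ?X (Some ` M)" using assms openin_sphere_complement_Some by blast
  have top: "topspace ?X = insert None (Some ` (- D))"
    by (auto simp: sphere_complement_eq riemann_sphere_def)
  have "topspace ?X - Some ` M = insert None (Some ` (- D - M))" unfolding top by auto
  moreover have "openin ?X (insert None (Some ` (- D - M)))"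
    using assms openin_sphere_complement_None by blast
  moreover have "Some ` M \<subseteq> topspace ?X" unfolding top using assms by auto
  ultimately show "closedin ?X (Some ` M)" unfolding closedin_def by simp
qed

section \<open>The finitely many components of the complement\<close>

locale nondegenerate_complement =
  fixes D :: "complex set" and X :: "complex option topology"
  defines "X \<equiv> subtopology riemann_sphere (sphere_complement D)"
  assumes dom: "planar_domain D"
    and fin: "finite (connected_components_of X)"
    and nonsing: "C \<in> connected_components_of X \<Longrightarrow> \<not> is_singleton C"
begin

lemma domain: "open D" "connected D" "D \<noteq> {}"
  using dom by (auto simp: planar_domain_def)

lemma topspace_X: "topspace X = insert None (Some ` (- D))"
  by (auto simp: X_def sphere_complement_eq riemann_sphere_def)

text \<open>Components are always closed; finiteness enters here and makes them open as
  well.\<close>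

lemma component_clopen:
  assumes "C \<in> connected_components_of X"
  shows "openin X C" "openin X (topspace X - C)" "connectedin X C"
  using assms fin closedin_connected_components_of[OF assms]
  by (auto simp: open_in_finite_connected_components closedin_def connectedin_connected_components_of)

text \<open>A clopen set cannot split a connected one. This supplies the clopen hypotheses of the
  planar lemmas.\<close>

lemma component_clopen_subset:
  assumes "C \<in> connected_components_of X" "open V" "compact M" "M = V - D" "Some ` M \<subseteq> C"
  shows "M = {} \<or> C = Some ` M"
  using connectedin_clopen_cases[OF component_clopen(3)[OF assms(1)],
      unfolded X_def, OF clopen_sphere_complement_Some(2,1)[OF assms(2-4)]] assms(5)
  by (auto simp: disjnt_def)

lemma unbounded_component:
  obtains F K where "insert None (Some ` F) \<in> connected_components_of X"
    "compact K" "D \<union> K = - F" "open (D \<union> K)" "D \<union> K \<noteq> UNIV"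
    "\<And>M. \<lbrakk>compact M; openin (top_of_set (- (D \<union> K))) M\<rbrakk> \<Longrightarrow> M = {}"
proof -
  obtain C where C: "C \<in> connected_components_of X" "None \<in> C"
    using topspace_X Union_connected_components_of[of X] by blast
  define F where "F = Some -` C"
  have CF: "C = insert None (Some ` F)"
  proof (intro set_eqI)
    fix x show "x \<in> C \<longleftrightarrow> x \<in> insert None (Some ` F)"
      using C by (cases x) (auto simp: F_def)
  qed
  have FD: "F \<subseteq> - D"
    using connected_components_of_subset[OF C(1)] by (auto simp: topspace_X CF)
  obtain Q where Q: "compact Q" "F = - D - Q"
    using component_clopen(1)[OF C(1)] openin_sphere_complement_None by (auto simp: X_def CF)
  have "topspace X - C = Some ` (- D - F)" by (auto simp: topspace_X CF)
  then obtain V where V: "open V" "- D - F = V - D"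
    using component_clopen(2)[OF C(1)] openin_sphere_complement_Some by (auto simp: X_def)
  define K where "K = - D - F"
  have DK: "D \<union> K = - F" using FD by (auto simp: K_def)
  show thesis
  proof
    show "insert None (Some ` F) \<in> connected_components_of X" using C CF by simp
    have "K = Q \<inter> - D" using Q by (auto simp: K_def)
    then show "compact K" using Q domain by (simp add: compact_Int_closed closed_Compl)
    show "D \<union> K = - F" by (fact DK)
    have "D \<union> K = D \<union> V" using V by (auto simp: K_def)
    then show "open (D \<union> K)" using domain V by auto
    \<comment> \<open>Otherwise the component would consist of infinity alone.\<close>
    show "D \<union> K \<noteq> UNIV" using nonsing[OF C(1)] DK by (auto simp: CF is_singleton_def)
    fix M assume M: "compact M" "openin (top_of_set (- (D \<union> K))) M"
    then obtain T where T: "open T" "M = F \<inter> T" by (auto simp: DK openin_open)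
    \<comment> \<open>Removing \<open>Q\<close> ensures that \<open>T - Q\<close> meets the
      complement of \<open>D\<close> only in points of \<open>F\<close>.\<close>
    moreover have "M = (T - Q) - D" using T Q by auto
    moreover have "open (T - Q)" using T Q by (simp add: open_Diff compact_imp_closed)
    ultimately have "M = {} \<or> C = Some ` M"
      using component_clopen_subset[OF C(1) _ M(1), of "T - Q"] CF by blast
    then show "M = {}" using C by auto
  qed
qed

text \<open>Reduces to \<open>squeezing_maps_bounded_component\<close>: openness of the component
  provides \<open>V\<close>, and openness of the rest, a neighbourhood of infinity, provides
  compactness.\<close>

lemma bounded_component:
  assumes C: "C \<in> connected_components_of X" "None \<notin> C" and \<epsilon>: "0 < \<epsilon>"
  obtains L where "closed L" "Some ` L \<inter> C = {}"
    "\<And>z. z \<in> D - L \<Longrightarrow> \<exists>h \<in> squeezing_maps D z. ball 0 (1 - \<epsilon>) \<subseteq> h ` D"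
proof -
  define F where "F = Some -` C"
  have CF: "C = Some ` F"
  proof (intro set_eqI)
    fix x show "x \<in> C \<longleftrightarrow> x \<in> Some ` F"
      using C by (cases x) (auto simp: F_def)
  qed
  have FD: "F \<subseteq> - D"
    using connected_components_of_subset[OF C(1)] by (auto simp: topspace_X CF)
  obtain V where V: "open V" "F = V - D"
    using component_clopen(1)[OF C(1)] openin_sphere_complement_Some by (auto simp: X_def CF)
  have "topspace X - C = insert None (Some ` (- D - F))" by (auto simp: topspace_X CF)
  then obtain Q where Q: "compact Q" "- D - F = - D - Q"
    using component_clopen(2)[OF C(1)] openin_sphere_complement_None by (auto simp: X_def)
  have "F = Q \<inter> - D" using Q FD by blast
  then have "compact F" using Q domain by (simp add: compact_Int_closed closed_Compl)
  have "F \<noteq> {}" using nonempty_connected_components_of[OF C(1)] CF by blast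
  then obtain a where "a \<in> F" by blast
  have "F \<noteq> {a}" using nonsing[OF C(1)] by (auto simp: CF)
  have "M = {} \<or> M = F" if M: "M \<subseteq> F" "compact M" "openin (top_of_set F) M" for M
  proof -
    obtain T where "open T" "M = F \<inter> T" using M by (auto simp: openin_open)
    then have "open (T \<inter> V)" "M = (T \<inter> V) - D" using V by auto
    then have "M = {} \<or> C = Some ` M"
      using component_clopen_subset[OF C(1) _ M(2), of "T \<inter> V"] CF M(1) by blast
    then show ?thesis by (auto simp: CF inj_image_eq_iff)
  qed
  then obtain L where "closed L" "L \<inter> F = {}"
    "\<And>z. z \<in> D - L \<Longrightarrow> \<exists>h \<in> squeezing_maps D z. ball 0 (1 - \<epsilon>) \<subseteq> h ` D"
    using squeezing_maps_bounded_component[OF domain \<open>compact F\<close> V \<open>a \<in> F\<close> \<open>F \<noteq> {a}\<close> _ \<epsilon>] by metis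
  then show thesis using that[of L] CF by blast
qed

text \<open>Each component \<open>C\<close> gets a closed set \<open>L C\<close> disjoint from it
  such that suitable maps exist at points of \<open>D\<close> off \<open>L C\<close>. The components
  cover the complement, so the intersection of these sets lies in \<open>D\<close>.\<close>

lemma squeezing_limit: "squeezing_tends_to_one_at_boundary D"
  unfolding squeezing_tends_to_one_at_boundary_def
proof (intro allI impI)
  fix \<epsilon> :: real assume "0 < \<epsilon>"
  \<comment> \<open>Below \<open>\<epsilon>\<close> for the strict inequality, and below 1 so that
    the radius \<open>1 - \<delta>\<close> is positive.\<close>
  define \<delta> where "\<delta> = min (\<epsilon> / 2) (1 / 2)"
  have \<delta>: "0 < \<delta>" "\<delta> < \<epsilon>" "\<delta> < 1" using \<open>0 < \<epsilon>\<close> by (auto simp: \<delta>_def)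
  let ?good = "\<lambda>z. \<exists>h \<in> squeezing_maps D z. ball 0 (1 - \<delta>) \<subseteq> h ` D"
  obtain F K where F: "insert None (Some ` F) \<in> connected_components_of X"
    and DK: "compact K" "D \<union> K = - F" "open (D \<union> K)" "D \<union> K \<noteq> UNIV"
    "\<And>M. \<lbrakk>compact M; openin (top_of_set (- (D \<union> K))) M\<rbrakk> \<Longrightarrow> M = {}"
    using unbounded_component by metis
  obtain L0 where L0: "compact L0" "L0 \<subseteq> D \<union> K" "\<And>z. z \<in> D - L0 \<Longrightarrow> ?good z"
    using squeezing_maps_Un_compact[OF domain(2,3) DK(1,3,4,5) \<delta>(1)] by metis
  have "\<exists>L. closed L \<and> Some ` L \<inter> C = {} \<and> (\<forall>z\<in>D - L. ?good z)"
    if "C \<in> connected_components_of X" for C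
  proof (cases "None \<in> C")
    case True
    then have "C = insert None (Some ` F)"
      using connected_components_of_overlap[OF that F] by blast
    then show ?thesis using L0 DK(2) by (intro exI[of _ L0]) (auto simp: compact_imp_closed)
  next
    case False
    then show ?thesis using bounded_component[OF that False \<delta>(1)] by metis
  qed
  then obtain L where L: "\<And>C. C \<in> connected_components_of X \<Longrightarrow> closed (L C)"
    "\<And>C. C \<in> connected_components_of X \<Longrightarrow> Some ` L C \<inter> C = {}"
    "\<And>C z. C \<in> connected_components_of X \<Longrightarrow> z \<in> D - L C \<Longrightarrow> ?good z"
    by metis
  \<comment> \<open>\<open>L0\<close> makes the intersection compact. A point of \<open>D\<close>
    outside \<open>S\<close> misses \<open>L0\<close> or some \<open>L C\<close>, and either case
    yields a map.\<close>
  define S where "S = L0 \<inter> (\<Inter>C\<in>connected_components_of X. L C)"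
  have "compact S" unfolding S_def using L0 L by (intro compact_Int_closed closed_INT) auto
  moreover have "S \<subseteq> D"
  proof
    fix z assume "z \<in> S"
    show "z \<in> D"
    proof (rule ccontr)
      assume "z \<notin> D"
      then obtain C where "C \<in> connected_components_of X" "Some z \<in> C"
        using topspace_X Union_connected_components_of[of X] by blast
      then show False using L(2) \<open>z \<in> S\<close> by (fastforce simp: S_def)
    qed
  qed
  moreover have "squeezing_function D z > 1 - \<epsilon>" if "z \<in> D - S" for z
  proof -
    have "?good z" using that L(3) L0(3) by (fastforce simp: S_def)
    then obtain h where "h \<in> squeezing_maps D z" "ball 0 (1 - \<delta>) \<subseteq> h ` D" by blast
    then have "1 - \<delta> \<le> squeezing_function D z"
      using le_squeezing_function[OF dom] that \<delta> by simp
    then show ?thesis using \<delta> by linarith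
  qed
  ultimately show "\<exists>K. compact K \<and> K \<subseteq> D \<and> (\<forall>z\<in>D - K. squeezing_function D z > 1 - \<epsilon>)"
    by blast
qed

text \<open>The component through infinity suffices: a Riemann map of \<open>D \<union> K\<close>
  restricts to \<open>D\<close>.\<close>

lemma bounded_embedding:
  obtains f where "f holomorphic_on D" "inj_on f D" "f ` D \<subseteq> ball 0 1"
proof -
  obtain K where DK: "compact K" "open (D \<union> K)" "D \<union> K \<noteq> UNIV"
    "\<And>M. \<lbrakk>compact M; openin (top_of_set (- (D \<union> K))) M\<rbrakk> \<Longrightarrow> M = {}"
    using unbounded_component by metis
  obtain f g where "f holomorphic_on (D \<union> K)"
    and gf: "\<And>z. z \<in> D \<union> K \<Longrightarrow> f z \<in> ball 0 1 \<and> g (f z) = z"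
    using Riemann_map_Un_compact[OF domain(2,3) DK] by metis
  then have "f holomorphic_on D" "f ` D \<subseteq> ball 0 1" by (auto intro: holomorphic_on_subset)
  moreover have "inj_on f D" using gf by (metis UnI1 inj_on_inverseI)
  ultimately show thesis using that by blast
qed

end

section \<open>Uniform lower bounds and homogeneous regularity\<close>

text \<open>By compactness one radius \<open>d\<close> works for discs in the image of
  \<open>D\<close> around all points of the image of \<open>K\<close>; recentring \<open>f\<close>
  at each point keeps a fixed fraction of it.\<close>

lemma squeezing_function_lower_bound_on_compact:
  assumes dom: "planar_domain D" and f: "f holomorphic_on D" "inj_on f D" "f ` D \<subseteq> ball 0 1"
    and K: "compact K" "K \<subseteq> D"
  obtains c where "c > 0" "\<And>z. z \<in> K \<Longrightarrow> c \<le> squeezing_function D z"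
proof -
  have "open (f ` D)" using dom f by (intro open_mapping_thm3) (auto simp: planar_domain_def)
  moreover have "compact (f ` K)"
    using f K by (intro compact_continuous_image) (auto intro: holomorphic_on_imp_continuous_on holomorphic_on_subset)
  ultimately obtain d where d: "d > 0" "(\<Union>y\<in>f ` K. ball y d) \<subseteq> f ` D"
    using compact_subset_open_imp_ball_epsilon_subset[of "f ` K" "f ` D"] K by blast
  have "d / 2 \<le> squeezing_function D z" if z: "z \<in> K" for z
  proof (rule le_squeezing_function[OF dom])
    \<comment> \<open>The difference of two points of the unit disc has norm below 2, so halving
      returns it to the disc, at the cost of halving \<open>d\<close>.\<close>
    define h where "h = (\<lambda>x. (f x - f z) / 2)"
    show "z \<in> D" using z K by blast
    have "norm (h x) < 1" if "x \<in> D" for x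
    proof -
      have "norm (f x) < 1" "norm (f z) < 1" using f that \<open>z \<in> D\<close> by auto
      then show ?thesis
        using norm_triangle_ineq4[of "f x" "f z"] by (simp add: h_def norm_divide)
    qed
    moreover have "h holomorphic_on D" unfolding h_def using f by (intro holomorphic_intros) auto
    moreover have "inj_on h D" using f by (auto simp: h_def inj_on_def)
    ultimately show "h \<in> squeezing_maps D z" by (auto simp: squeezing_maps_def h_def)
    show "0 < d / 2" using d by simp
    show "ball 0 (d / 2) \<subseteq> h ` D"
    proof
      fix y :: complex assume "y \<in> ball 0 (d / 2)"
      then have "f z + 2 * y \<in> ball (f z) d" by (simp add: dist_norm norm_mult)
      then obtain x where "x \<in> D" "f x = f z + 2 * y" using d(2) z by force
      then show "y \<in> h ` D" by (auto simp: h_def image_iff intro!: bexI[of _ x])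
    qed
  qed
  then show thesis using that[of "d / 2"] d by simp
qed

text \<open>The limit gives the bound 1/2 off a compact set, and the previous lemma covers that set.
  The image of \<open>f\<close> is the bounded model, since an injective holomorphic map has a
  holomorphic inverse.\<close>

lemma holomorphic_homogeneous_regular_if_bounded_embedding:
  assumes dom: "planar_domain D" and f: "f holomorphic_on D" "inj_on f D" "f ` D \<subseteq> ball 0 1"
    and lim: "squeezing_tends_to_one_at_boundary D"
  shows "holomorphic_homogeneous_regular D"
proof -
  have D: "open D" "connected D" "D \<noteq> {}" using dom by (auto simp: planar_domain_def)
  obtain g where "g holomorphic_on f ` D" "\<And>z. z \<in> D \<Longrightarrow> g (f z) = z"
    using holomorphic_has_inverse[OF f(1) D(1) f(2)] by metis
  then have "biholomorphic D (f ` D)"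
    unfolding biholomorphic_def using f by (intro exI[of _ f] exI[of _ g]) auto
  moreover have "planar_domain (f ` D)"
    unfolding planar_domain_def using D f open_mapping_thm3[OF f(1) D(1) f(2)]
    by (auto intro: connected_continuous_image holomorphic_on_imp_continuous_on)
  moreover have "bounded (f ` D)" using f bounded_subset bounded_ball by blast
  moreover have "\<exists>c>0. \<forall>z\<in>D. c \<le> squeezing_function D z"
  proof -
    obtain K where K: "compact K" "K \<subseteq> D" "\<And>z. z \<in> D - K \<Longrightarrow> squeezing_function D z > 1 - 1 / 2"
      using lim half_gt_zero[of "1::real"] unfolding squeezing_tends_to_one_at_boundary_def
      by (metis zero_less_one)
    obtain c where c: "c > 0" "\<And>z. z \<in> K \<Longrightarrow> c \<le> squeezing_function D z"
      using squeezing_function_lower_bound_on_compact[OF dom f K(1,2)] by metis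
    have "min c (1 / 2) \<le> squeezing_function D z" if "z \<in> D" for z
      using c(2)[of z] K(3)[of z] that by (cases "z \<in> K") auto
    then show ?thesis using c by (intro exI[of _ "min c (1 / 2)"]) auto
  qed
  ultimately show ?thesis unfolding holomorphic_homogeneous_regular_def using dom by blast
qed

theorem theorem5p2:
  fixes D :: "complex set"
  assumes "planar_domain D"
    and "finite (connected_components_of (subtopology riemann_sphere (sphere_complement D)))"
    and "\<And>C. C \<in> connected_components_of (subtopology riemann_sphere (sphere_complement D))
           \<Longrightarrow> \<not> is_singleton C"
  shows "squeezing_tends_to_one_at_boundary D \<and> holomorphic_homogeneous_regular D"
proof -
  interpret nondegenerate_complement D "subtopology riemann_sphere (sphere_complement D)"
    using assms by unfold_locales
  show ?thesis
    using squeezing_limit bounded_embedding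
      holomorphic_homogeneous_regular_if_bounded_embedding[OF assms(1)] by metis
qed

end
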